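(* Let $I$ be a monomial ideal in $\Bbbk[\mathbb{N}A]$. Then $I$ has finitely many standard pairs.
   Context: Standing assumptions: $\mathbb{N}=\{0,1,2,\dots\}$; $\Bbbk$ is an infinite field; $A=\{a_1,\dots,a_n\}\subset\mathbb{Z}^d\setminus\{0\}$ is a fixed finite set. $\mathbb{N}A$, $\mathbb{Z}A$, $\mathbb{R}_{\ge 0}A$ denote respectively the monoid of nonnegative integer combinations, the group of integer combinations, and the cone of nonnegative real combinations of elements of $A$ (similarly for subsets of $A$). It is assumed that $\mathbb{Z}A=\mathbb{Z}^d$ and that the cone $\mathbb{R}_{\ge 0}A$ is strongly convex (contains no lines). $\Bbbk[\mathbb{N}A]$ is the subring of the Laurent polynomial ring $\Bbbk[t_1^{\pm1},\dots,t_d^{\pm1}]$ with $\Bbbk$-basis the monomials $t^a$, $a\in\mathbb{N}A$. A monomial ideal is an ideal of $\Bbbk[\mathbb{N}A]$ generated by monomials $t^a$, $a \in \mathbb{N}A$. A face of $A$ is a subset $F\subseteq A$ such that $\mathbb{R}_{\ge0}F$ is a face of the cone $\mathbb{R}_{\ge0}A$ and $\mathbb{R}_{\ge0}F\cap A=F$ (both $F=A$ and $F=\varnothing$, the latter corresponding to the origin, are allowed). A pair of $A$ is $(a,F)$ with $a\in\mathbb{N}A$ and $F$ a face of $A$; it is said to belong to $F$. Write $(a,F)\prec(b,G)$ if $a+\mathbb{N}F\subseteq b+\mathbb{N}G$. For a monomial ideal $I$, $\mathrm{std}(I)=\{a\in\mathbb{N}A\mid t^a\notin I\}$. A proper pair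 of $I$ is a pair $(a,F)$ with $a+\mathbb{N}F\subseteq\mathrm{std}(I)$. A standard pair of $I$ is a proper pair of $I$ that is maximal with respect to $\prec$ among proper pairs of $I$. *)

theory Defs
  imports "HOL-Analysis.Analysis" "HOL-Library.Poly_Mapping" "HOL-Algebra.Ideal"
begin

definition nat_span :: "(int ^ 'd) set \<Rightarrow> (int ^ 'd) set" where
  "nat_span A = {\<Sum>a\<in>A. int (c a) *s a | c :: int ^ 'd \<Rightarrow> nat. True}"

definition int_span :: "(int ^ 'd) set \<Rightarrow> (int ^ 'd) set" where
  "int_span A = {\<Sum>a\<in>A. c a *s a | c :: int ^ 'd \<Rightarrow> int. True}"

definition real_vec :: "int ^ 'd \<Rightarrow> real ^ 'd" where
  "real_vec a = (\<chi> i. real_of_int (a $ i))"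

definition real_cone :: "(int ^ 'd) set \<Rightarrow> (real ^ 'd) set" where
  "real_cone A = {\<Sum>a\<in>A. c a *\<^sub>R real_vec a | c :: int ^ 'd \<Rightarrow> real. \<forall>a\<in>A. 0 \<le> c a}"

definition contains_line :: "('v :: real_vector) set \<Rightarrow> bool" where
  "contains_line C \<longleftrightarrow> (\<exists>p v. v \<noteq> 0 \<and> (\<forall>t :: real. p + t *\<^sub>R v \<in> C))"

(* A Laurent polynomial over 'k in d variables is a finitely supported map from the exponent
   group int ^ 'd to 'k, with the convolution product of Poly_Mapping; t^a is Poly_Mapping.single a 1. *)
type_synonym ('d, 'k) laurent = "(int ^ 'd) \<Rightarrow>\<^sub>0 'k"

definition laurent_monom :: "int ^ 'd \<Rightarrow> ('d, 'k :: field) laurent" where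
  "laurent_monom a = Poly_Mapping.single a 1"

definition semigroup_ring :: "(int ^ 'd) set \<Rightarrow> ('d, 'k :: field) laurent ring" where
  "semigroup_ring A =
     \<lparr>carrier = {p. Poly_Mapping.keys p \<subseteq> nat_span A}, monoid.mult = (*), one = 1,
      ring.zero = 0, ring.add = (+)\<rparr>"

definition monomial_ideal :: "(int ^ 'd) set \<Rightarrow> ('d, 'k :: field) laurent set \<Rightarrow> bool" where
  "monomial_ideal A I \<longleftrightarrow> ideal I (semigroup_ring A) \<and>
     (\<exists>M \<subseteq> nat_span A. I = genideal (semigroup_ring A) (laurent_monom ` M))"

(* The library's face_of also admits the empty set, but real_cone F always contains 0, so
   F = {} corresponds to the origin. *)
definition is_face :: "(int ^ 'd) set \<Rightarrow> (int ^ 'd) set \<Rightarrow> bool" where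
  "is_face A F \<longleftrightarrow> F \<subseteq> A \<and> real_cone F face_of real_cone A \<and>
     {a \<in> A. real_vec a \<in> real_cone F} = F"

type_synonym 'd pair = "(int ^ 'd) \<times> (int ^ 'd) set"

definition is_pair :: "(int ^ 'd) set \<Rightarrow> ('d :: finite) pair \<Rightarrow> bool" where
  "is_pair A p \<longleftrightarrow> fst p \<in> nat_span A \<and> is_face A (snd p)"

definition pair_set :: "('d :: finite) pair \<Rightarrow> (int ^ 'd) set" where
  "pair_set p = (\<lambda>x. fst p + x) ` nat_span (snd p)"

definition pair_le :: "('d :: finite) pair \<Rightarrow> 'd pair \<Rightarrow> bool" where
  "pair_le p q \<longleftrightarrow> pair_set p \<subseteq> pair_set q"

definition std :: "(int ^ 'd) set \<Rightarrow> ('d, 'k :: field) laurent set \<Rightarrow> (int ^ 'd) set" where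
  "std A I = {a \<in> nat_span A. laurent_monom a \<notin> I}"

definition proper_pair :: "(int ^ 'd) set \<Rightarrow> ('d, 'k :: field) laurent set \<Rightarrow> ('d :: finite) pair \<Rightarrow> bool" where
  "proper_pair A I p \<longleftrightarrow> is_pair A p \<and> pair_set p \<subseteq> std A I"

(* Maximality is stated so as to make sense for any preorder; when the cone over A contains no
   line, pair_le is antisymmetric on pairs of A and the conclusion amounts to q = p. *)
definition standard_pair :: "(int ^ 'd) set \<Rightarrow> ('d, 'k :: field) laurent set \<Rightarrow> ('d :: finite) pair \<Rightarrow> bool" where
  "standard_pair A I p \<longleftrightarrow> proper_pair A I p \<and>
     (\<forall>q. proper_pair A I q \<and> pair_le p q \<longrightarrow> pair_le q p)"

end

theory Submission
  imports Defs
begin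

text \<open>
  The standard monomials of a monomial ideal are closed under taking divisors in \<open>nat_span A\<close>;
  the argument below exploits this and Dickson's lemma. Since \<open>A\<close> has finitely many faces, an infinite set of
  standard pairs would contain infinitely many pairs \<open>(a\<^sub>k, F)\<close> belonging to one face \<open>F\<close>.
  Write each \<open>a\<^sub>k\<close> with nonnegative coefficients on \<open>A\<close>. After passing to a subsequence every
  coefficient is either constant or strictly increasing in \<open>k\<close>; let \<open>J\<close> collect the
  generators with increasing coefficient and put \<open>h = \<Sum>F + \<Sum>J\<close>.

  Every \<open>a\<^sub>0 + m h\<close> divides \<open>a\<^sub>m + m \<Sum>F\<close> and is therefore standard. Let \<open>G\<close> be the smallest
  face whose cone contains \<open>h\<close>. As \<open>h\<close> lies in the relative interior of that cone, each element
  of \<open>nat_span G\<close> divides a multiple of \<open>h\<close> (lemma \<open>face_at_span_divides\<close>), so that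
  \<open>a\<^sub>0 + nat_span G\<close> is standard as well. Hence \<open>(a\<^sub>0, G)\<close> is a proper pair above \<open>(a\<^sub>0, F)\<close>, and
  maximality of the latter forces \<open>J \<subseteq> G \<subseteq> nat_span F\<close>. But then
  \<open>a\<^sub>1 - a\<^sub>0 \<in> nat_span J \<subseteq> nat_span F\<close>, so \<open>(a\<^sub>1, F)\<close> lies below \<open>(a\<^sub>0, F)\<close>. Maximality of
  \<open>(a\<^sub>1, F)\<close> gives \<open>a\<^sub>0 - a\<^sub>1 \<in> nat_span F\<close> too, and because the cone contains no line,
  \<open>a\<^sub>0 = a\<^sub>1\<close>, a contradiction.

  The passage from the real cone, in which faces live, to the monoid is the pigeonhole argument
  of lemma \<open>multiple_minus_generator_in_nat_span\<close>.
\<close>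

section \<open>Monoids of nonnegative integer combinations\<close>

lemma nat_spanI:
  assumes "\<And>b. b \<in> A \<Longrightarrow> 0 \<le> c b"
  shows "(\<Sum>b\<in>A. c b *s b) \<in> nat_span A"
proof -
  have "(\<Sum>b\<in>A. c b *s b) = (\<Sum>b\<in>A. int (nat (c b)) *s b)"
    using assms by (intro sum.cong) auto
  then show ?thesis
    unfolding nat_span_def by (auto intro!: exI[of _ "\<lambda>b. nat (c b)"])
qed

lemma nat_span_zero: "0 \<in> nat_span A"
  using nat_spanI[of A "\<lambda>_. 0"] by simp

lemma nat_span_add:
  assumes "x \<in> nat_span A" "y \<in> nat_span A"
  shows "x + y \<in> nat_span A"
proof -
  obtain c d where "x = (\<Sum>a\<in>A. int (c a) *s a)" "y = (\<Sum>a\<in>A. int (d a) *s a)"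
    using assms unfolding nat_span_def by auto
  then have "x + y = (\<Sum>a\<in>A. (int (c a) + int (d a)) *s a)"
    by (simp add: sum.distrib vector_sadd_rdistrib)
  then show ?thesis
    using nat_spanI[of A "\<lambda>a. int (c a) + int (d a)"] by simp
qed

lemma nat_span_scale:
  assumes "x \<in> nat_span A"
  shows "int m *s x \<in> nat_span A"
proof (induction m)
  case 0
  then show ?case by (simp add: nat_span_zero)
next
  case (Suc m)
  then show ?case using nat_span_add[OF assms Suc]
    by (simp add: vector_sadd_rdistrib)
qed

lemma nat_span_sum:
  assumes "\<And>i. i \<in> S \<Longrightarrow> f i \<in> nat_span A"
  shows "(\<Sum>i\<in>S. f i) \<in> nat_span A"
  using assms
  by (induction S rule: infinite_finite_induct) (auto simp: nat_span_zero nat_span_add)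

lemma nat_span_gen:
  assumes "finite A" "a \<in> A"
  shows "a \<in> nat_span A"
proof -
  have "(\<Sum>b\<in>A. (if b = a then 1 else 0) *s b) = (\<Sum>b\<in>A. if b = a then b else 0)"
    by (intro sum.cong) auto
  then have "(\<Sum>b\<in>A. (if b = a then 1 else 0) *s b) = a"
    using assms by simp
  then show ?thesis
    using nat_spanI[of A "\<lambda>b. if b = a then 1 else 0"] by simp
qed

lemma nat_span_least:
  assumes "S \<subseteq> nat_span A"
  shows "nat_span S \<subseteq> nat_span A"
proof
  fix x assume "x \<in> nat_span S"
  then obtain c where "x = (\<Sum>a\<in>S. int (c a) *s a)"
    unfolding nat_span_def by auto
  then show "x \<in> nat_span A"
    using assms by (auto intro!: nat_span_sum nat_span_scale)
qed

lemma nat_span_mono: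
  assumes "finite A" "S \<subseteq> A"
  shows "nat_span S \<subseteq> nat_span A"
  using assms by (intro nat_span_least) (auto intro: nat_span_gen)

section \<open>Real cones\<close>

lemma real_vec_zero: "real_vec 0 = 0"
  by (simp add: real_vec_def vec_eq_iff)

lemma real_vec_add: "real_vec (a + b) = real_vec a + real_vec b"
  by (simp add: real_vec_def vec_eq_iff)

lemma real_vec_uminus: "real_vec (- a) = - real_vec a"
  by (simp add: real_vec_def vec_eq_iff)

lemma real_vec_scale: "real_vec (k *s a) = real_of_int k *\<^sub>R real_vec a"
  by (simp add: real_vec_def vec_eq_iff)

lemma real_vec_sum: "real_vec (\<Sum>i\<in>S. f i) = (\<Sum>i\<in>S. real_vec (f i))"
  by (induction S rule: infinite_finite_induct) (auto simp: real_vec_zero real_vec_add)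

lemma real_vec_eq_iff: "real_vec a = real_vec b \<longleftrightarrow> a = b"
  by (simp add: real_vec_def vec_eq_iff)

lemma real_coneI:
  "(\<And>a. a \<in> A \<Longrightarrow> 0 \<le> c a) \<Longrightarrow> (\<Sum>a\<in>A. c a *\<^sub>R real_vec a) \<in> real_cone A"
  unfolding real_cone_def by auto

lemma real_coneE:
  assumes "x \<in> real_cone A"
  obtains c where "\<And>a. a \<in> A \<Longrightarrow> 0 \<le> c a" "x = (\<Sum>a\<in>A. c a *\<^sub>R real_vec a)"
  using assms unfolding real_cone_def by auto

lemma real_cone_zero: "0 \<in> real_cone A"
  using real_coneI[of A "\<lambda>_. 0"] by simp

lemma real_cone_add:
  assumes "x \<in> real_cone A" "y \<in> real_cone A"
  shows "x + y \<in> real_cone A"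
proof -
  obtain c where c: "\<And>a. a \<in> A \<Longrightarrow> 0 \<le> c a" "x = (\<Sum>a\<in>A. c a *\<^sub>R real_vec a)"
    using assms(1) by (metis real_coneE)
  obtain d where d: "\<And>a. a \<in> A \<Longrightarrow> 0 \<le> d a" "y = (\<Sum>a\<in>A. d a *\<^sub>R real_vec a)"
    using assms(2) by (metis real_coneE)
  from c d show ?thesis
    using real_coneI[of A "\<lambda>a. c a + d a"] by (simp add: sum.distrib scaleR_add_left)
qed

lemma real_cone_scale:
  assumes "x \<in> real_cone A" "0 \<le> t"
  shows "t *\<^sub>R x \<in> real_cone A"
proof -
  obtain c where "\<And>a. a \<in> A \<Longrightarrow> 0 \<le> c a" "x = (\<Sum>a\<in>A. c a *\<^sub>R real_vec a)"
    using assms by (metis real_coneE)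
  then show ?thesis
    using assms real_coneI[of A "\<lambda>a. t * c a"] by (simp add: scaleR_sum_right)
qed

lemma real_cone_sum:
  assumes "\<And>i. i \<in> S \<Longrightarrow> f i \<in> real_cone A"
  shows "(\<Sum>i\<in>S. f i) \<in> real_cone A"
  using assms
  by (induction S rule: infinite_finite_induct) (auto simp: real_cone_zero real_cone_add)

lemma convex_real_cone: "convex (real_cone A)"
  by (auto simp: convex_def intro!: real_cone_add real_cone_scale)

lemma real_cone_mono:
  assumes "finite A" "S \<subseteq> A"
  shows "real_cone S \<subseteq> real_cone A"
proof
  fix x assume "x \<in> real_cone S"
  then obtain c where c: "\<And>a. a \<in> S \<Longrightarrow> 0 \<le> c a" "x = (\<Sum>a\<in>S. c a *\<^sub>R real_vec a)"
    by (metis real_coneE)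
  have "x = (\<Sum>a\<in>A. (if a \<in> S then c a else 0) *\<^sub>R real_vec a)"
    unfolding c(2) using assms by (intro sum.mono_neutral_cong_left) auto
  then show "x \<in> real_cone A"
    using c(1) real_coneI[of A "\<lambda>a. if a \<in> S then c a else 0"] by auto
qed

lemma real_vec_nat_span_in_cone:
  assumes "x \<in> nat_span A"
  shows "real_vec x \<in> real_cone A"
proof -
  obtain c where "x = (\<Sum>a\<in>A. int (c a) *s a)"
    using assms unfolding nat_span_def by auto
  then show ?thesis
    using real_coneI[of A "\<lambda>a. real (c a)"] by (simp add: real_vec_sum real_vec_scale)
qed

lemma nat_span_pointed:
  assumes "\<not> contains_line (real_cone A)" "x \<in> nat_span A" "- x \<in> nat_span A"
  shows "x = 0"
proof (rule ccontr)
  assume "x \<noteq> 0"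
  then have "real_vec x \<noteq> 0"
    using real_vec_eq_iff[of x 0] by (simp add: real_vec_zero)
  moreover have "0 + t *\<^sub>R real_vec x \<in> real_cone A" for t :: real
  proof (cases "0 \<le> t")
    case True
    then show ?thesis
      using real_cone_scale[OF real_vec_nat_span_in_cone[OF assms(2)]] by simp
  next
    case False
    then show ?thesis
      using real_cone_scale[OF real_vec_nat_span_in_cone[OF assms(3)], of "- t"]
      by (simp add: real_vec_uminus)
  qed
  ultimately show False
    using assms(1) unfolding contains_line_def by blast
qed

section \<open>The smallest face around a point of the cone\<close>

text \<open>
  For \<open>h\<close> in the cone, these are the generators lying on the smallest face that contains \<open>h\<close>:
  moving from \<open>h\<close> a little in the direction opposite to \<open>a\<close> stays inside the cone exactly when
  \<open>a\<close> belongs to that face.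
\<close>
definition face_at :: "(int ^ 'd) set \<Rightarrow> real ^ 'd \<Rightarrow> (int ^ 'd) set" where
  "face_at A h = {a \<in> A. \<exists>e>0. h - e *\<^sub>R real_vec a \<in> real_cone A}"

text \<open>
  The point \<open>h\<close> dominates \<open>e\<^sub>g g\<close> for each generator \<open>g\<close> of its face and some \<open>e\<^sub>g > 0\<close>; summing
  these relations, a multiple of \<open>h\<close> dominates every point of the cone over the face.
\<close>
lemma face_at_cone_bounded:
  assumes "h \<in> real_cone A" "x \<in> real_cone (face_at A h)"
  obtains K where "K > 0" "K *\<^sub>R h - x \<in> real_cone A"
proof -
  let ?G = "face_at A h"
  obtain c where c: "\<And>g. g \<in> ?G \<Longrightarrow> 0 \<le> c g" "x = (\<Sum>g\<in>?G. c g *\<^sub>R real_vec g)"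
    using assms(2) by (metis real_coneE)
  have "\<forall>g\<in>?G. \<exists>e>0. h - e *\<^sub>R real_vec g \<in> real_cone A"
    by (auto simp: face_at_def)
  then obtain e where e: "\<And>g. g \<in> ?G \<Longrightarrow> e g > 0"
    "\<And>g. g \<in> ?G \<Longrightarrow> h - e g *\<^sub>R real_vec g \<in> real_cone A"
    by metis
  define K where "K = (\<Sum>g\<in>?G. c g / e g)"
  have "K \<ge> 0"
    unfolding K_def using c(1) e(1) by (intro sum_nonneg) (simp add: less_imp_le)
  have "K *\<^sub>R h - x = (\<Sum>g\<in>?G. (c g / e g) *\<^sub>R h - c g *\<^sub>R real_vec g)"
    by (simp add: K_def c(2) sum_subtractf scaleR_sum_left)
  also have "\<dots> = (\<Sum>g\<in>?G. (c g / e g) *\<^sub>R (h - e g *\<^sub>R real_vec g))"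
  proof (intro sum.cong refl)
    fix g assume "g \<in> ?G"
    then have "e g \<noteq> 0" using e(1)[of g] by simp
    then show "(c g / e g) *\<^sub>R h - c g *\<^sub>R real_vec g = (c g / e g) *\<^sub>R (h - e g *\<^sub>R real_vec g)"
      by (simp add: scaleR_diff_right)
  qed
  also have "\<dots> \<in> real_cone A"
    using c(1) e by (intro real_cone_sum real_cone_scale) (auto simp: less_imp_le)
  \<comment> \<open>\<open>K\<close> vanishes when \<open>x = 0\<close>, so one further copy of \<open>h\<close> is added to get a positive factor.\<close>
  finally have "(K *\<^sub>R h - x) + h \<in> real_cone A"
    using assms(1) by (rule real_cone_add)
  then have "(K + 1) *\<^sub>R h - x \<in> real_cone A"
    by (simp add: scaleR_add_left algebra_simps)
  with \<open>K \<ge> 0\<close> show ?thesis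
    by (intro that[of "K + 1"]) auto
qed

lemma face_atI:
  assumes "h \<in> real_cone A" "x \<in> real_cone (face_at A h)"
    and "a \<in> A" "e > 0" "x - e *\<^sub>R real_vec a \<in> real_cone A"
  shows "a \<in> face_at A h"
proof -
  obtain K where K: "K > 0" "K *\<^sub>R h - x \<in> real_cone A"
    using face_at_cone_bounded[OF assms(1,2)] .
  have "(1 / K) *\<^sub>R ((K *\<^sub>R h - x) + (x - e *\<^sub>R real_vec a)) \<in> real_cone A"
    using K assms(5) by (intro real_cone_scale real_cone_add) auto
  then have "h - (e / K) *\<^sub>R real_vec a \<in> real_cone A"
    using K(1) by (simp add: scaleR_diff_right)
  moreover have "e / K > 0"
    using K(1) assms(4) by simp
  ultimately show ?thesis
    using assms(3) unfolding face_at_def by blast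
qed

text \<open>
  If a positive combination of \<open>u\<close> and \<open>v\<close> lies in the cone over \<open>face_at A h\<close>, then so does every
  generator used in \<open>u\<close>, because a positive multiple of it can be subtracted from that combination.
\<close>
lemma face_at_summand:
  assumes "finite A" "h \<in> real_cone A"
    and "u \<in> real_cone A" "v \<in> real_cone A" "s > 0" "t > 0"
    and "s *\<^sub>R u + t *\<^sub>R v \<in> real_cone (face_at A h)"
  shows "u \<in> real_cone (face_at A h)"
proof -
  let ?G = "face_at A h"
  obtain c where c: "\<And>a. a \<in> A \<Longrightarrow> 0 \<le> c a" "u = (\<Sum>a\<in>A. c a *\<^sub>R real_vec a)"
    using assms(3) by (metis real_coneE)
  have inG: "a \<in> ?G" if a: "a \<in> A" "c a \<noteq> 0" for a
  proof (rule face_atI[OF assms(2,7)])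
    have "u - c a *\<^sub>R real_vec a = (\<Sum>b\<in>A - {a}. c b *\<^sub>R real_vec b)"
      unfolding c(2) using assms(1) a(1) by (simp add: sum.remove)
    also have "\<dots> \<in> real_cone (A - {a})"
      using c(1) by (intro real_coneI) auto
    also have "\<dots> \<subseteq> real_cone A"
      using assms(1) by (intro real_cone_mono) auto
    finally have "s *\<^sub>R (u - c a *\<^sub>R real_vec a) + t *\<^sub>R v \<in> real_cone A"
      using assms by (intro real_cone_add real_cone_scale) auto
    then show "s *\<^sub>R u + t *\<^sub>R v - (s * c a) *\<^sub>R real_vec a \<in> real_cone A"
      by (simp add: algebra_simps)
    show "s * c a > 0"
      using assms(5) c(1)[of a] a by simp
  qed (use a in auto)
  have "u = (\<Sum>a\<in>?G. c a *\<^sub>R real_vec a)"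
    unfolding c(2) using assms(1) inG
    by (intro sum.mono_neutral_right) (auto simp: face_at_def)
  then show ?thesis
    using real_coneI[of ?G c] c(1) by (auto simp: face_at_def)
qed

lemma is_face_face_at:
  assumes "finite A" "h \<in> real_cone A"
  shows "is_face A (face_at A h)"
proof -
  let ?G = "face_at A h"
  have GA: "?G \<subseteq> A"
    by (auto simp: face_at_def)
  have "real_cone ?G face_of real_cone A"
    unfolding face_of_def
  proof (intro conjI ballI impI)
    show "real_cone ?G \<subseteq> real_cone A"
      using assms(1) GA by (rule real_cone_mono)
    show "convex (real_cone ?G)"
      by (rule convex_real_cone)
    fix u v x
    assume uv: "u \<in> real_cone A" "v \<in> real_cone A" and x: "x \<in> real_cone ?G"
      and "x \<in> open_segment u v"
    then obtain t where t: "0 < t" "t < 1" "x = (1 - t) *\<^sub>R u + t *\<^sub>R v"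
      by (auto simp: in_segment)
    show "u \<in> real_cone ?G"
      using face_at_summand[OF assms uv, of "1 - t" t] t x by simp
    show "v \<in> real_cone ?G"
      using face_at_summand[OF assms uv(2,1), of t "1 - t"] t x by (simp add: add.commute)
  qed
  moreover have "{a \<in> A. real_vec a \<in> real_cone ?G} = ?G"
  proof (intro subset_antisym subsetI)
    fix a assume "a \<in> {a \<in> A. real_vec a \<in> real_cone ?G}"
    then show "a \<in> ?G"
      using face_atI[OF assms(2), of "real_vec a" a 1] by (simp add: real_cone_zero)
  next
    fix a assume "a \<in> ?G"
    moreover from this have "a \<in> nat_span ?G"
      using finite_subset[OF GA assms(1)] by (intro nat_span_gen)
    ultimately show "a \<in> {a \<in> A. real_vec a \<in> real_cone ?G}"
      using GA real_vec_nat_span_in_cone by auto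
  qed
  ultimately show ?thesis
    using GA unfolding is_face_def by blast
qed

section \<open>From the real cone to the monoid\<close>

lemma finite_int_box:
  fixes M :: "'d::finite \<Rightarrow> int"
  shows "finite {v :: int ^ 'd. \<forall>i. \<bar>v $ i\<bar> \<le> M i}"
proof -
  have "{v :: int ^ 'd. \<forall>i. \<bar>v $ i\<bar> \<le> M i} \<subseteq> vec_lambda ` (PiE UNIV (\<lambda>i. {- M i..M i}))"
  proof
    fix v :: "int ^ 'd" assume v: "v \<in> {v. \<forall>i. \<bar>v $ i\<bar> \<le> M i}"
    have "v = vec_lambda (vec_nth v)" by simp
    moreover have "vec_nth v \<in> PiE UNIV (\<lambda>i. {- M i..M i})"
      using v by (auto simp: abs_le_iff minus_le_iff)
    ultimately show "v \<in> vec_lambda ` (PiE UNIV (\<lambda>i. {- M i..M i}))" by blast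
  qed
  moreover have "finite (PiE (UNIV :: 'd set) (\<lambda>i. {- M i..M i}))"
    by (intro finite_PiE) auto
  ultimately show ?thesis
    by (meson finite_imageI finite_subset)
qed

text \<open>
  A real relation \<open>h = \<Sum>b\<in>A. x\<^sub>b b\<close> between integer vectors yields an integer one for a multiple
  of \<open>h\<close>. The remainders \<open>N h - \<Sum>b\<in>A. \<lfloor>N x\<^sub>b\<rfloor> b\<close> are integer vectors in a bounded region, so two of
  them, for \<open>N < N'\<close> as far apart as desired, agree; subtracting gives \<open>(N' - N) h\<close> as a
  combination with coefficients \<open>\<lfloor>N' x\<^sub>b\<rfloor> - \<lfloor>N x\<^sub>b\<rfloor> \<ge> 0\<close>, and the coefficient of \<open>a\<close> is positive
  once \<open>(N' - N) x\<^sub>a \<ge> 1\<close>.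
\<close>
lemma multiple_minus_generator_in_nat_span:
  fixes A :: "(int ^ 'd::finite) set"
  assumes "finite A" "a \<in> A"
    and x: "\<And>b. b \<in> A \<Longrightarrow> 0 \<le> x b" "0 < x a"
    and h: "real_vec h = (\<Sum>b\<in>A. x b *\<^sub>R real_vec b)"
  shows "\<exists>m. int m *s h - a \<in> nat_span A"
proof -
  define q where "q N b = \<lfloor>real N * x b\<rfloor>" for N b
  \<comment> \<open>\<open>r N\<close> equals \<open>\<Sum>b\<in>A. frac (N x\<^sub>b) b\<close>, whence the bound \<open>M\<close> that is independent of \<open>N\<close>.\<close>
  define r where "r N = int N *s h - (\<Sum>b\<in>A. q N b *s b)" for N
  define M where "M i = (\<Sum>b\<in>A. \<bar>b $ i\<bar>)" for i
  have bound: "\<bar>r N $ i\<bar> \<le> M i" for N i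
  proof -
    have hi: "real_of_int (h $ i) = (\<Sum>b\<in>A. x b * real_of_int (b $ i))"
      using arg_cong[OF h, of "\<lambda>v. v $ i"] by (simp add: real_vec_def)
    have "real_of_int (r N $ i) = (\<Sum>b\<in>A. frac (real N * x b) * real_of_int (b $ i))"
      by (simp add: r_def q_def frac_def hi sum_subtractf sum_distrib_left left_diff_distrib
          mult.assoc)
    also have "\<bar>\<dots>\<bar> \<le> (\<Sum>b\<in>A. \<bar>frac (real N * x b) * real_of_int (b $ i)\<bar>)"
      by (rule sum_abs)
    also have "\<dots> \<le> (\<Sum>b\<in>A. \<bar>real_of_int (b $ i)\<bar>)"
    proof (intro sum_mono)
      fix b
      have "\<bar>frac (real N * x b)\<bar> \<le> 1"
        using frac_ge_0[of "real N * x b"] frac_lt_1[of "real N * x b"] by linarith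
      then show "\<bar>frac (real N * x b) * real_of_int (b $ i)\<bar> \<le> \<bar>real_of_int (b $ i)\<bar>"
        by (simp add: abs_mult mult_left_le_one_le)
    qed
    also have "\<dots> = real_of_int (M i)"
      by (simp add: M_def)
    finally show ?thesis
      by linarith
  qed
  have "finite (range r)"
    by (rule finite_subset[OF _ finite_int_box[of M]]) (use bound in auto)
  then obtain N where inf: "infinite {N'. r N' = r N}"
    using pigeonhole_infinite[of UNIV r] by auto
  obtain K where K: "1 \<le> real K * x a"
    using x(2) by (metis less_imp_le reals_Archimedean3)
  obtain N' where N': "N' \<ge> N + K" "r N' = r N"
    using inf by (metis (mono_tags, lifting) infinite_nat_iff_unbounded_le mem_Collect_eq)
  define c where "c b = q N' b - q N b - (if b = a then 1 else 0)" for b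
  have "0 \<le> c b" if b: "b \<in> A" for b
  proof (cases "b = a")
    case True
    have "real N * x a + 1 \<le> real (N + K) * x a"
      using K by (simp add: algebra_simps)
    also have "\<dots> \<le> real N' * x a"
      using N'(1) x(2) by (intro mult_right_mono) auto
    finally have "q N a + 1 \<le> q N' a"
      unfolding q_def by linarith
    then show ?thesis
      using True by (simp add: c_def)
  next
    case False
    have "real N * x b \<le> real N' * x b"
      using N'(1) x(1)[OF b] by (intro mult_right_mono) auto
    then show ?thesis
      using False by (simp add: c_def q_def floor_mono)
  qed
  then have "(\<Sum>b\<in>A. c b *s b) \<in> nat_span A"
    by (rule nat_spanI)
  moreover have "(\<Sum>b\<in>A. c b *s b) = int (N' - N) *s h - a"
  proof -
    have "(\<Sum>b\<in>A. (if b = a then 1 else 0) *s b) = (\<Sum>b\<in>A. if b = a then b else 0)"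
      by (intro sum.cong) auto
    also have "\<dots> = a"
      using assms(1,2) by simp
    finally have "(\<Sum>b\<in>A. c b *s b) = (\<Sum>b\<in>A. q N' b *s b) - (\<Sum>b\<in>A. q N b *s b) - a"
      by (simp add: c_def sum_subtractf vector_sub_rdistrib)
    also have "\<dots> = int N' *s h - int N *s h - a"
      using N'(2) by (simp add: r_def algebra_simps)
    also have "\<dots> = int (N' - N) *s h - a"
      using N'(1) by (simp add: of_nat_diff vector_sub_rdistrib)
    finally show ?thesis .
  qed
  ultimately show ?thesis
    by auto
qed

lemma face_at_span_divides:
  fixes A :: "(int ^ 'd::finite) set"
  assumes "finite A" and g: "g \<in> nat_span (face_at A (real_vec h))"
  shows "\<exists>m. int m *s h - g \<in> nat_span A"
proof -
  let ?G = "face_at A (real_vec h)"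
  have "\<exists>m. int m *s h - a \<in> nat_span A" if "a \<in> ?G" for a
  proof -
    obtain e where e: "a \<in> A" "e > 0" "real_vec h - e *\<^sub>R real_vec a \<in> real_cone A"
      using \<open>a \<in> ?G\<close> by (auto simp: face_at_def)
    then obtain c where c: "\<And>b. b \<in> A \<Longrightarrow> 0 \<le> c b"
      "real_vec h - e *\<^sub>R real_vec a = (\<Sum>b\<in>A. c b *\<^sub>R real_vec b)"
      by (metis real_coneE)
    have "(\<Sum>b\<in>A. (if b = a then e else 0) *\<^sub>R real_vec b)
        = (\<Sum>b\<in>A. if b = a then e *\<^sub>R real_vec b else 0)"
      by (intro sum.cong) auto
    also have "\<dots> = e *\<^sub>R real_vec a"
      using assms(1) e(1) by simp
    finally have "real_vec h = (\<Sum>b\<in>A. (c b + (if b = a then e else 0)) *\<^sub>R real_vec b)"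
      using c(2) by (simp add: scaleR_add_left sum.distrib algebra_simps)
    moreover have "c a + (if a = a then e else 0) > 0"
      using c(1)[OF e(1)] e(2) by simp
    ultimately show ?thesis
      using c(1) e(2) assms(1) e(1)
      by (intro multiple_minus_generator_in_nat_span[where x = "\<lambda>b. c b + (if b = a then e else 0)"])
        auto
  qed
  then obtain m where m: "\<And>a. a \<in> ?G \<Longrightarrow> int (m a) *s h - a \<in> nat_span A"
    by metis
  obtain c where c: "g = (\<Sum>a\<in>?G. int (c a) *s a)"
    using g unfolding nat_span_def by auto
  have "int (\<Sum>a\<in>?G. c a * m a) *s h - g = (\<Sum>a\<in>?G. int (c a) *s (int (m a) *s h - a))"
    by (simp add: c sum_subtractf vec_eq_iff sum_distrib_left algebra_simps)
  also have "\<dots> \<in> nat_span A"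
    using m by (intro nat_span_sum nat_span_scale)
  finally show ?thesis
    by blast
qed

section \<open>Subsequences with constant or increasing coefficients\<close>

lemma nat_seq_const_or_strict_subseq:
  fixes s :: "nat \<Rightarrow> nat"
  obtains r :: "nat \<Rightarrow> nat" where "strict_mono r"
    "(\<forall>k. s (r k) = s (r 0)) \<or> strict_mono (s \<circ> r)"
proof (cases "finite (range s)")
  case True
  then obtain n where "infinite {n'. s n' = s n}"
    using pigeonhole_infinite[of UNIV s] by auto
  then have "strict_mono (enumerate {n'. s n' = s n})"
    and "s (enumerate {n'. s n' = s n} k) = s n" for k
    using enumerate_in_set[of "{n'. s n' = s n}" k] by (auto intro: strict_mono_enumerate)
  then show ?thesis
    by (intro that) auto
next
  case False
  have "\<exists>m>n. s m > s n" for n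
  proof (rule ccontr)
    assume "\<not> ?thesis"
    then have "range s \<subseteq> s ` {..n} \<union> {..s n}"
      by (auto simp: not_less)
    then show False
      using False by (meson finite_Un finite_atMost finite_imageI finite_subset)
  qed
  then obtain r where "\<forall>n. r n < r (Suc n) \<and> s (r n) < s (r (Suc n))"
    using dependent_nat_choice[of "\<lambda>_ _. True" "\<lambda>_ n m. n < m \<and> s n < s m"] by auto
  then show ?thesis
    by (intro that[of r]) (auto simp: strict_mono_Suc_iff)
qed

text \<open>
  Dickson's lemma usually asks only for a coordinatewise weakly increasing subsequence. Here the
  growing coordinates have to be told apart from the constant ones, because exactly the
  growing ones give directions along which a proper pair extends.
\<close>
lemma subseq_const_or_strict:
  fixes c :: "nat \<Rightarrow> 'b \<Rightarrow> nat"
  assumes "finite A"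
  shows "\<exists>r :: nat \<Rightarrow> nat. strict_mono r \<and>
    (\<forall>b\<in>A. (\<forall>k. c (r k) b = c (r 0) b) \<or> strict_mono (\<lambda>k. c (r k) b))"
  using assms
proof (induction A)
  case empty
  then show ?case
    by (auto intro!: exI[of _ id] simp: strict_mono_def)
next
  case (insert x A)
  then obtain r :: "nat \<Rightarrow> nat" where r: "strict_mono r"
    "\<And>b. b \<in> A \<Longrightarrow> (\<forall>k. c (r k) b = c (r 0) b) \<or> strict_mono (\<lambda>k. c (r k) b)"
    by blast
  obtain r' :: "nat \<Rightarrow> nat" where r': "strict_mono r'"
    "(\<forall>k. c (r (r' k)) x = c (r (r' 0)) x) \<or> strict_mono ((\<lambda>k. c (r k) x) \<circ> r')"
    using nat_seq_const_or_strict_subseq[of "\<lambda>k. c (r k) x"] by metis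
  have "(\<forall>k. c (r (r' k)) b = c (r (r' 0)) b) \<or> strict_mono (\<lambda>k. c (r (r' k)) b)"
    if "b \<in> insert x A" for b
  proof (cases "b = x")
    case True
    then show ?thesis using r'(2) by (simp add: o_def)
  next
    case False
    then have "(\<forall>k. c (r k) b = c (r 0) b) \<or> strict_mono (\<lambda>k. c (r k) b)"
      using r(2) that by blast
    then show ?thesis
    proof
      assume *: "\<forall>k. c (r k) b = c (r 0) b"
      have "\<forall>k. c (r (r' k)) b = c (r (r' 0)) b"
        using * by metis
      then show ?thesis ..
    next
      assume "strict_mono (\<lambda>k. c (r k) b)"
      then show ?thesis
        using r'(1) by (auto simp: strict_mono_def)
    qed
  qed
  moreover have "strict_mono (\<lambda>k. r (r' k))"
    using r(1) r'(1) by (simp add: strict_mono_def)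
  ultimately show ?case
    by (intro exI[of _ "\<lambda>k. r (r' k)"]) blast
qed

section \<open>Standard pairs\<close>

lemma std_divisor_closed:
  fixes I :: "('d::finite, 'k :: field) laurent set"
  assumes "monomial_ideal A I" and "a \<in> nat_span A" "b \<in> nat_span A" "a + b \<in> std A I"
  shows "a \<in> std A I"
proof -
  have ideal: "ideal I (semigroup_ring A)"
    using assms(1) by (simp add: monomial_ideal_def)
  have "laurent_monom b \<in> carrier (semigroup_ring A :: ('d, 'k) laurent ring)"
    using assms(3) by (simp add: laurent_monom_def semigroup_ring_def)
  moreover have "laurent_monom b \<otimes>\<^bsub>semigroup_ring A\<^esub> laurent_monom a
      = (laurent_monom (a + b) :: ('d, 'k) laurent)"
    by (simp add: semigroup_ring_def laurent_monom_def mult_single add.commute)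
  ultimately have "(laurent_monom (a + b) :: ('d, 'k) laurent) \<in> I"
    if "(laurent_monom a :: ('d, 'k) laurent) \<in> I"
    using ideal.I_l_closed[OF ideal that] by metis
  then show ?thesis
    using assms(2,4) by (auto simp: std_def)
qed

text \<open>
  A standard pair already contains every direction in which its face can be enlarged. If each
  \<open>a + m \<Sum>J\<close> divides the base point \<open>u\<close> of a proper pair with the same face \<open>F\<close>, then the
  divisors of \<open>u + nat_span F\<close> fill up a translate by \<open>a\<close> of the whole monoid over the smallest
  face containing \<open>F \<union> J\<close>, and maximality of \<open>(a, F)\<close> puts this monoid inside \<open>nat_span F\<close>.
\<close>
lemma standard_pair_absorbs:
  fixes A :: "(int ^ 'd::finite) set" and I :: "('d, 'k :: field) laurent set"
  assumes "finite A" "monomial_ideal A I" "standard_pair A I (a, F)" "J \<subseteq> A"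
    and cofinal: "\<And>m. \<exists>u. proper_pair A I (u, F) \<and> u - a - int m *s \<Sum>J \<in> nat_span A"
  shows "J \<subseteq> nat_span F"
proof -
  have proper: "proper_pair A I (a, F)"
    using assms(3) by (simp add: standard_pair_def)
  then have a: "a \<in> nat_span A" and face: "is_face A F"
    by (auto simp: proper_pair_def is_pair_def)
  have FA: "F \<subseteq> A"
    using face by (simp add: is_face_def)
  have fin: "finite F" "finite J"
    using FA assms(1,4) finite_subset by auto
  define h where "h = \<Sum>F + \<Sum>J"
  let ?G = "face_at A (real_vec h)"
  have gen: "x \<in> nat_span A" if "x \<in> A" for x
    using assms(1) that by (rule nat_span_gen)
  have h: "h \<in> nat_span A"
    unfolding h_def using FA assms(4) gen by (intro nat_span_add nat_span_sum) auto
  have hcone: "real_vec h \<in> real_cone A"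
    using h by (rule real_vec_nat_span_in_cone)
  have sub: "F \<union> J \<subseteq> ?G"
  proof
    fix x assume x: "x \<in> F \<union> J"
    have sum_minus: "\<Sum>S - x \<in> nat_span A" if "finite S" "S \<subseteq> A" "x \<in> S" for S
    proof -
      have "\<Sum>S - x = \<Sum>(S - {x})"
        using that by (simp add: sum.remove)
      also have "\<dots> \<in> nat_span A"
        using that gen by (intro nat_span_sum) auto
      finally show ?thesis .
    qed
    have sums: "\<Sum>F \<in> nat_span A" "\<Sum>J \<in> nat_span A"
      using FA assms(4) gen by (auto intro!: nat_span_sum)
    have "h - x \<in> nat_span A"
    proof (cases "x \<in> F")
      case True
      then show ?thesis
        using nat_span_add[OF sum_minus[OF fin(1) FA True] sums(2)]
        by (simp add: h_def algebra_simps)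
    next
      case False
      then have "x \<in> J" using x by simp
      then show ?thesis
        using nat_span_add[OF sum_minus[OF fin(2) assms(4)] sums(1)]
        by (simp add: h_def algebra_simps)
    qed
    then have "real_vec h - 1 *\<^sub>R real_vec x \<in> real_cone A"
      using real_vec_nat_span_in_cone[of "h - x" A] real_vec_add[of h "- x"]
      by (simp add: real_vec_uminus)
    then show "x \<in> ?G"
      using x FA assms(4) zero_less_one unfolding face_at_def by blast
  qed
  have multiples: "a + int m *s h \<in> std A I" for m
  proof -
    obtain u where u: "proper_pair A I (u, F)" "u - a - int m *s \<Sum>J \<in> nat_span A"
      using cofinal by blast
    have "int m *s \<Sum>F \<in> nat_span F"
      using fin(1) by (intro nat_span_scale nat_span_sum nat_span_gen)
    then have "u + int m *s \<Sum>F \<in> std A I"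
      using u(1) by (auto simp: proper_pair_def pair_set_def)
    moreover have "u + int m *s \<Sum>F = (a + int m *s h) + (u - a - int m *s \<Sum>J)"
      by (simp add: h_def vector_add_ldistrib)
    ultimately have "(a + int m *s h) + (u - a - int m *s \<Sum>J) \<in> std A I"
      by simp
    then show ?thesis
      by (rule std_divisor_closed[OF assms(2) nat_span_add[OF a nat_span_scale[OF h]] u(2)])
  qed
  have GA: "nat_span ?G \<subseteq> nat_span A"
    using assms(1) by (intro nat_span_mono) (auto simp: face_at_def)
  have "proper_pair A I (a, ?G)"
    unfolding proper_pair_def is_pair_def pair_set_def
  proof (intro conjI image_subsetI; simp)
    show "a \<in> nat_span A" by (rule a)
    show "is_face A ?G"
      using assms(1) hcone by (rule is_face_face_at)
    fix g assume g: "g \<in> nat_span ?G"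
    then obtain m where m: "int m *s h - g \<in> nat_span A"
      using face_at_span_divides[OF assms(1)] by blast
    have "a + g \<in> nat_span A"
      using a g GA by (auto intro: nat_span_add)
    moreover have "(a + g) + (int m *s h - g) \<in> std A I"
      using multiples[of m] by simp
    ultimately show "a + g \<in> std A I"
      using m std_divisor_closed[OF assms(2)] by blast
  qed
  moreover have "pair_le (a, F) (a, ?G)"
  proof -
    have "nat_span F \<subseteq> nat_span ?G"
      using sub assms(1) by (intro nat_span_mono) (auto intro: finite_subset simp: face_at_def)
    then show ?thesis
      by (auto simp: pair_le_def pair_set_def)
  qed
  ultimately have "pair_le (a, ?G) (a, F)"
    using assms(3) by (simp add: standard_pair_def)
  then have "nat_span ?G \<subseteq> nat_span F"
    by (auto simp: pair_le_def pair_set_def)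
  moreover have "?G \<subseteq> nat_span ?G"
    using assms(1) by (auto intro!: nat_span_gen simp: face_at_def)
  ultimately show ?thesis
    using sub by blast
qed

text \<open>
  The hypothesis makes \<open>(b, F)\<close> smaller than \<open>(a, F)\<close>, so maximality of \<open>(b, F)\<close> yields
  \<open>a - b \<in> nat_span F\<close> as well; in a pointed monoid this forces equality.
\<close>
lemma standard_pair_comparable_eq:
  fixes A :: "(int ^ 'd::finite) set" and I :: "('d, 'k :: field) laurent set"
  assumes "finite A" "\<not> contains_line (real_cone A)"
    and "standard_pair A I (a, F)" "standard_pair A I (b, F)" "b - a \<in> nat_span F"
  shows "a = b"
proof -
  have "F \<subseteq> A"
    using assms(3) by (auto simp: standard_pair_def proper_pair_def is_pair_def is_face_def)
  then have FA: "nat_span F \<subseteq> nat_span A"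
    using assms(1) by (intro nat_span_mono)
  have "b + x \<in> (+) a ` nat_span F" if "x \<in> nat_span F" for x
    using nat_span_add[OF assms(5) that] by (intro image_eqI[of _ _ "b - a + x"]) auto
  then have "pair_le (b, F) (a, F)"
    by (auto simp: pair_le_def pair_set_def)
  then have "pair_le (a, F) (b, F)"
    using assms(3,4) by (simp add: standard_pair_def)
  then have "(+) a ` nat_span F \<subseteq> (+) b ` nat_span F"
    by (simp add: pair_le_def pair_set_def)
  then have "a + 0 \<in> (+) b ` nat_span F"
    using nat_span_zero by blast
  then have "a - b \<in> nat_span F"
    by auto
  then have "b - a = 0"
    using assms(5) FA by (intro nat_span_pointed[OF assms(2)]) auto
  then show ?thesis by simp
qed

lemma finite_standard_pairs_of_face:
  fixes A :: "(int ^ 'd::finite) set" and I :: "('d, 'k :: field) laurent set"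
  assumes "finite A" "\<not> contains_line (real_cone A)" "monomial_ideal A I"
  shows "finite {a. standard_pair A I (a, F)}"
proof (rule ccontr)
  assume "infinite {a. standard_pair A I (a, F)}"
  then obtain s :: "nat \<Rightarrow> int ^ 'd" where s: "inj s" "\<And>k. standard_pair A I (s k, F)"
    using infinite_countable_subset[of "{a. standard_pair A I (a, F)}"] by auto
  then have proper: "proper_pair A I (s k, F)" for k
    by (simp add: standard_pair_def)
  then have "\<forall>k. \<exists>c. s k = (\<Sum>a\<in>A. int (c a) *s a)"
    by (auto simp: proper_pair_def is_pair_def nat_span_def)
  then obtain c where c: "\<And>k. s k = (\<Sum>a\<in>A. int (c k a) *s a)"
    by metis
  obtain r :: "nat \<Rightarrow> nat" where r: "strict_mono r"
    "\<And>b. b \<in> A \<Longrightarrow> (\<forall>k. c (r k) b = c (r 0) b) \<or> strict_mono (\<lambda>k. c (r k) b)"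
    using subseq_const_or_strict[OF assms(1), of c] by blast
  define J where "J = {b \<in> A. strict_mono (\<lambda>k. c (r k) b)}"
  have J: "J \<subseteq> A"
    by (auto simp: J_def)
  \<comment> \<open>Strict growth of natural numbers makes the increment at least \<open>k\<close> after \<open>k\<close> steps, so the
    \<open>m\<close>-th term of the subsequence is a witness for \<open>m\<close> in \<open>standard_pair_absorbs\<close>.\<close>
  define d where "d k b = int (c (r k) b) - int (c (r 0) b)" for k b
  have d_const: "d k b = 0" if "b \<in> A - J" for k b
    using r(2)[of b] that unfolding J_def d_def by (metis (mono_tags, lifting) DiffE diff_self mem_Collect_eq)
  have d_grows: "int k \<le> d k b" if "b \<in> J" for k b
  proof (induction k)
    case (Suc k)
    have "c (r k) b < c (r (Suc k)) b"
      using that by (simp add: J_def strict_mono_def)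
    then show ?case using Suc by (simp add: d_def)
  qed (simp add: d_def)
  have diff: "s (r k) - s (r 0) = (\<Sum>b\<in>J. d k b *s b)" for k
  proof -
    have "s (r k) - s (r 0) = (\<Sum>b\<in>A. d k b *s b)"
      by (simp add: c d_def vector_sub_rdistrib sum_subtractf)
    also have "\<dots> = (\<Sum>b\<in>J. d k b *s b)"
      using assms(1) J d_const by (intro sum.mono_neutral_right) auto
    finally show ?thesis .
  qed
  have "J \<subseteq> nat_span F"
  proof (rule standard_pair_absorbs[OF assms(1,3) s(2) J])
    fix m
    have "s (r m) - s (r 0) - int m *s \<Sum>J = (\<Sum>b\<in>J. (d m b - int m) *s b)"
      by (simp add: diff vector_sub_rdistrib sum_subtractf vec_eq_iff sum_distrib_left)
    also have "\<dots> \<in> nat_span J"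
      using d_grows by (intro nat_spanI) auto
    also have "\<dots> \<subseteq> nat_span A"
      using assms(1) J by (rule nat_span_mono)
    finally show "\<exists>u. proper_pair A I (u, F) \<and> u - s (r 0) - int m *s \<Sum>J \<in> nat_span A"
      using proper by blast
  qed
  then have "nat_span J \<subseteq> nat_span F"
    by (rule nat_span_least)
  moreover have "s (r 1) - s (r 0) \<in> nat_span J"
    unfolding diff using d_grows[of _ 1] by (intro nat_spanI) (metis of_nat_0_le_iff order_trans)
  ultimately have "s (r 0) = s (r 1)"
    by (intro standard_pair_comparable_eq[OF assms(1,2) s(2) s(2)]) auto
  then have "r 0 = r 1"
    using s(1) by (simp add: inj_eq)
  then show False
    using strict_monoD[OF r(1), of 0 1] by simp
qed

theorem theorem3p16:
  fixes A :: "(int ^ 'd) set"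
    and I :: "('d, 'k :: field) laurent set"
  assumes "infinite (UNIV :: 'k set)"
    and "finite A" and "0 \<notin> A"
    and "int_span A = UNIV"
    and "\<not> contains_line (real_cone A)"
    and "monomial_ideal A I"
  shows "finite {p. standard_pair A I p}"
proof -
  have "{p. standard_pair A I p} \<subseteq> (\<Union>F\<in>Pow A. (\<lambda>a. (a, F)) ` {a. standard_pair A I (a, F)})"
    by (auto simp: standard_pair_def proper_pair_def is_pair_def is_face_def)
  moreover have "finite \<dots>"
    using assms(2) finite_standard_pairs_of_face[OF assms(2,5,6)] by auto
  ultimately show ?thesis
    by (rule finite_subset)
qed

end
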